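(* Consider the random model below with $c=1$ and $f(x)=e^{-x}$, and let $\delta>0$. For any $m<\frac{0.05\,n^{1.5}}{\delta}$, if $X=(x_1,\dots,x_m)$ is sampled uniformly at random, then with probability $1-o(1)$ one can construct a position vector $Y$ which has the same vertex order as $X$ and is $\delta$-far from $X$ such that for any tester $\Psi$ (a function from graphs to $\{X,Y\}$), if $Z$ is chosen uniformly at random from $\{X,Y\}$ and a graph $G$ is sampled according to $Z$, then $\Psi(G)\neq Z$ with at least a constant probability.
   Context: Random model: for a position vector $Z=(z_1,\dots,z_m)\in[0,n]^m$, a graph $G$ on vertices $v_1,\dots,v_m$ is "sampled according to $Z$" by including each edge $\{v_i,v_j\}$ independently with probability $e^{-|z_i-z_j|}$. $X$ "sampled uniformly at random" means each $x_i$ is independent and uniform on $[0,n]$. Two position vectors $X,Y$ have the same vertex order if $x_i<x_j \iff y_i<y_j$ for all $i,j$. $X$ and $Y$ are $\delta$-far if $|x_i-y_i|>\delta$ for some $i$. "With probability $1-o(1)$" means with probability $1-1/\mathrm{poly}(n)$. *)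

theory Defs
  imports "HOL-Probability.Probability"
begin

text \<open>Vertices are the indices \<open>1, \<dots>, m\<close>. A position vector is a function on \<open>{1..m}\<close>, extended
  by \<open>undefined\<close> elsewhere, so that equality of functions is equality of vectors.\<close>

definition position_vectors :: "real \<Rightarrow> nat \<Rightarrow> (nat \<Rightarrow> real) set" where
  "position_vectors n m = ({1..m} \<rightarrow>\<^sub>E {0..n})"

definition uniform_positions :: "real \<Rightarrow> nat \<Rightarrow> (nat \<Rightarrow> real) measure" where
  "uniform_positions n m = (\<Pi>\<^sub>M i\<in>{1..m}. uniform_measure lborel {0..n})"

definition same_vertex_order :: "nat \<Rightarrow> (nat \<Rightarrow> real) \<Rightarrow> (nat \<Rightarrow> real) \<Rightarrow> bool" where
  "same_vertex_order m X Y \<longleftrightarrow> (\<forall>i\<in>{1..m}. \<forall>j\<in>{1..m}. X i < X j \<longleftrightarrow> Y i < Y j)"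

definition far :: "nat \<Rightarrow> real \<Rightarrow> (nat \<Rightarrow> real) \<Rightarrow> (nat \<Rightarrow> real) \<Rightarrow> bool" where
  "far m \<delta> X Y \<longleftrightarrow> (\<exists>i\<in>{1..m}. \<bar>X i - Y i\<bar> > \<delta>)"

text \<open>A simple graph on \<open>{1..m}\<close> is given by its set of edges, each a two-element vertex set.
  Every unordered pair is represented by exactly one element of \<open>vertex_pairs m\<close>, so each potential
  edge gets exactly one coin flip in \<open>sampled_graph\<close>.\<close>

definition vertex_pairs :: "nat \<Rightarrow> (nat \<times> nat) set" where
  "vertex_pairs m = {(i, j). 1 \<le> i \<and> i < j \<and> j \<le> m}"

definition graphs :: "nat \<Rightarrow> nat set set set" where
  "graphs m = Pow {{i, j} | i j. (i, j) \<in> vertex_pairs m}"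

definition sampled_graph :: "nat \<Rightarrow> (nat \<Rightarrow> real) \<Rightarrow> nat set set pmf" where
  "sampled_graph m Z =
     map_pmf (\<lambda>b. {{i, j} | i j. (i, j) \<in> vertex_pairs m \<and> b (i, j)})
       (Pi_pmf (vertex_pairs m) False (\<lambda>(i, j). bernoulli_pmf (exp (- \<bar>Z i - Z j\<bar>))))"

text \<open>Joint law of \<open>(Z, G)\<close>.\<close>

definition testing_experiment ::
    "nat \<Rightarrow> (nat \<Rightarrow> real) \<Rightarrow> (nat \<Rightarrow> real) \<Rightarrow> ((nat \<Rightarrow> real) \<times> nat set set) pmf" where
  "testing_experiment m X Y =
     bind_pmf (pmf_of_set {X, Y}) (\<lambda>Z. map_pmf (\<lambda>G. (Z, G)) (sampled_graph m Z))"

end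

theory Submission
  imports Defs "HOL-Real_Asymp.Real_Asymp"
begin

text \<open>If no \<open>x\<^sub>i\<close> exceeds \<open>n / 2\<close>, translate \<open>X\<close> by \<open>2 * \<delta>\<close>: the law of the graph does not
  change at all. Otherwise contract \<open>X\<close> by the factor \<open>1 - \<epsilon>\<close> with \<open>\<epsilon> = 3 * \<delta> / n\<close>, which moves the
  points beyond \<open>n / 2\<close> by more than \<open>\<delta>\<close>. A pair at distance \<open>d\<close> then contributes a factor of at
  most \<open>exp (32 * \<epsilon>\<^sup>2 * exp (- d / 8))\<close> to the second moment of the likelihood ratio, and these
  factors multiply over the independent edges. Hence every tester errs with constant probability
  as soon as the sum \<open>S\<close> of \<open>exp (- d / 8)\<close> over all pairs is \<open>O(n\<^sup>2 / \<delta>\<^sup>2)\<close>.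

  For uniform points the conditional mean of each summand given one of its endpoints is at most
  \<open>16 / n\<close>, whatever that endpoint is. Subtracting from each summand its conditional mean given the
  endpoint of smaller index turns \<open>S\<close> into a martingale in \<open>m\<close> with second moment at most
  \<open>16 * m ^ 3 / n\<close>, and Chebyshev's inequality shows that \<open>S > 2 * n\<^sup>2 / \<delta>\<^sup>2\<close> has probability
  \<open>O(\<delta> / sqrt n)\<close> for the given range of \<open>m\<close>.\<close>

section \<open>Testing error and likelihood ratios\<close>

text \<open>For any number l, expanding (Q - l P)^2 >= 0 and dividing by Q gives Q >= P (2 l - l^2
  P/Q). If 2 l <= 1, then P dominates the same expression. So whichever of P and Q a point is
  charged to, summing over the support of P bounds the total error below by 2 l - l^2 C.\<close>

lemma two_point_error_ge:
  fixes P Q :: "'a pmf"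
  assumes fin: "finite (set_pmf P)"
    and dom: "set_pmf P \<subseteq> set_pmf Q"
    and chi: "measure_pmf.expectation P (\<lambda>b. pmf P b / pmf Q b) \<le> C"
    and C: "C \<ge> 1"
  shows "3 / (4 * C) \<le> measure_pmf.prob P B + measure_pmf.prob Q (- B)"
proof -
  \<comment> \<open>The free maximiser of 2 l - l^2 C is 1/C. Half of it also meets 2 l <= 1 for
    every C >= 1, and yields 1/C - 1/(4 C) = 3/(4 C).\<close>
  define l where "l = 1 / (2 * C)"
  have l: "0 < l" "l \<le> 1/2" using C by (auto simp: l_def field_simps)
  have pointwise: "pmf P b * (2 * l - l^2 * (pmf P b / pmf Q b)) \<le> (if b \<in> B then pmf P b else pmf Q b)"
    if b: "b \<in> set_pmf P" for b
  proof -
    have pos: "pmf P b > 0" "pmf Q b > 0" using b dom by (auto simp: pmf_positive)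
    have "2 * l \<le> 1" using l by simp
    moreover have "0 \<le> l^2 * (pmf P b / pmf Q b)" using pos by simp
    ultimately have "2 * l - l^2 * (pmf P b / pmf Q b) \<le> 1" by linarith
    hence 1: "pmf P b * (2 * l - l^2 * (pmf P b / pmf Q b)) \<le> pmf P b"
      using pos mult_left_mono[of _ 1 "pmf P b"] by fastforce
    have "0 \<le> (pmf Q b - l * pmf P b)^2 / pmf Q b" using pos by simp
    also have "\<dots> = pmf Q b - pmf P b * (2 * l - l^2 * (pmf P b / pmf Q b))"
      using pos by (simp add: field_simps power2_eq_square)
    finally show ?thesis using 1 by auto
  qed
  have PB: "measure_pmf.prob P B = (\<Sum>b\<in>set_pmf P \<inter> B. pmf P b)"
    using measure_measure_pmf_finite[of "set_pmf P \<inter> B" P] fin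
    by (metis finite_Int inf_commute measure_Int_set_pmf)
  have QB: "(\<Sum>b\<in>set_pmf P - B. pmf Q b) \<le> measure_pmf.prob Q (- B)"
    using measure_measure_pmf_finite[of "set_pmf P - B" Q] fin
      measure_pmf.finite_measure_mono[of "set_pmf P - B" "- B" Q]
    by (simp add: Diff_eq)
  have E: "measure_pmf.expectation P f = (\<Sum>b\<in>set_pmf P. pmf P b * f b)" for f :: "'a \<Rightarrow> real"
    using integral_measure_pmf[of "set_pmf P" P f] fin by (simp add: mult.commute)
  have "3 / (4 * C) = 2 * l - l^2 * C" using C by (simp add: l_def field_simps power2_eq_square)
  also have "\<dots> \<le> 2 * l - l^2 * measure_pmf.expectation P (\<lambda>b. pmf P b / pmf Q b)"
    using chi by (intro diff_left_mono mult_left_mono) auto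
  also have "\<dots> = (\<Sum>b\<in>set_pmf P. pmf P b * (2 * l - l^2 * (pmf P b / pmf Q b)))"
    using fin sum_pmf_eq_1[OF fin order_refl]
    by (simp add: E right_diff_distrib sum_subtractf sum_distrib_left mult.left_commute[of "l\<^sup>2"]
          flip: sum_distrib_right)
  also have "\<dots> \<le> (\<Sum>b\<in>set_pmf P. if b \<in> B then pmf P b else pmf Q b)"
    by (intro sum_mono pointwise)
  also have "\<dots> = (\<Sum>b\<in>set_pmf P \<inter> B. pmf P b) + (\<Sum>b\<in>set_pmf P - B. pmf Q b)"
    using fin by (simp add: sum.If_cases Diff_eq Compl_eq)
  finally show ?thesis using PB QB by linarith
qed

text \<open>The coin flips behind \<open>sampled_graph\<close>, before they are turned into an edge
  set. Here the law is literally a product, so likelihood ratios factor over the edges.\<close>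

definition edge_coins :: "nat \<Rightarrow> (nat \<Rightarrow> real) \<Rightarrow> (nat \<times> nat \<Rightarrow> bool) pmf" where
  "edge_coins m Z =
     Pi_pmf (vertex_pairs m) False (\<lambda>(i, j). bernoulli_pmf (exp (- \<bar>Z i - Z j\<bar>)))"

lemma finite_vertex_pairs [simp, intro]: "finite (vertex_pairs m)"
  by (rule finite_subset[of _ "{1..m} \<times> {1..m}"]) (auto simp: vertex_pairs_def)

lemma testing_error_ge:
  assumes "X \<noteq> Y" and \<Psi>: "\<Psi> \<in> graphs m \<rightarrow> {X, Y}"
    and PQ: "\<And>B. 2 * p \<le> measure_pmf.prob (edge_coins m X) B + measure_pmf.prob (edge_coins m Y) (- B)"
  shows "p \<le> measure_pmf.prob (testing_experiment m X Y) {(Z, G). \<Psi> G \<noteq> Z}"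
proof -
  define g where "g = (\<lambda>b. {{i, j} | i j. (i, j) \<in> vertex_pairs m \<and> b (i, j)})"
  define B where "B = {b. \<Psi> (g b) \<noteq> X}"
  have "g b \<in> graphs m" for b by (auto simp: g_def graphs_def)
  hence "\<Psi> (g b) \<in> {X, Y}" for b using \<Psi> by auto
  \<comment> \<open>With only two possible answers, the outcomes that are wrong for \<open>Y\<close>
    are exactly those that are right for \<open>X\<close>.\<close>
  hence B': "{b. \<Psi> (g b) \<noteq> Y} = - B" using \<open>X \<noteq> Y\<close> by (fastforce simp: B_def)
  have fin: "finite (set_pmf (sampled_graph m Z))" for Z
    by (simp add: sampled_graph_def set_Pi_pmf finite_PiE_dflt)
  have err: "measure_pmf.prob (sampled_graph m Z) {G. \<Psi> G \<noteq> Z}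
      = measure_pmf.prob (edge_coins m Z) {b. \<Psi> (g b) \<noteq> Z}" for Z
    by (simp add: sampled_graph_def edge_coins_def g_def vimage_def)
  have "measure_pmf.prob (testing_experiment m X Y) {(Z, G). \<Psi> G \<noteq> Z}
      = measure_pmf.expectation (testing_experiment m X Y) (indicator {(Z, G). \<Psi> G \<noteq> Z})"
    by simp
  also have "\<dots> = (\<Sum>Z\<in>{X, Y}. measure_pmf.prob (edge_coins m Z) {b. \<Psi> (g b) \<noteq> Z} / 2)"
    unfolding testing_experiment_def using \<open>X \<noteq> Y\<close>
    by (subst pmf_expectation_bind_pmf_of_set) (simp_all add: fin err vimage_def)
  also have "\<dots> = (measure_pmf.prob (edge_coins m X) B + measure_pmf.prob (edge_coins m Y) (- B)) / 2"
    using \<open>X \<noteq> Y\<close> B' by (simp add: B_def)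
  finally show ?thesis using PQ[of B] by simp
qed

text \<open>The left side is the likelihood-ratio moment of one edge and equals 1 + (p - q)^2 / (p
  (1 - p)). Since p - q <= p e d, the excess is at most (e d)^2 p / (1 - p). For small d the pole of
  p / (1 - p) cancels only one factor d; for large d the quotient decays exponentially.\<close>

lemma chi_square_edge:
  fixes d e :: real
  assumes e: "0 < e" "e \<le> 1/2" and d: "0 \<le> d"
  defines "p \<equiv> exp (- ((1 - e) * d))" and "q \<equiv> exp (- d)"
  shows "q * (q / p) + (1 - q) * ((1 - q) / (1 - p)) \<le> exp (32 * e^2 * exp (- (d/8)))"
proof (cases "d = 0")
  case True
  thus ?thesis by (simp add: p_def q_def)
next
  case False
  with d have d: "d > 0" by simp
  have p: "0 < p" "p < 1" using d e by (auto simp: p_def)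
  \<comment> \<open>As e <= 1/2, the exponent (1 - e) d is at least d/2 = 2 v. Halving it again
    prepares the factorisation of exp (2 v) - 1 below.\<close>
  define v where "v = d / 4"
  have v: "v > 0" using d by (simp add: v_def)
  have "p - q = p * (1 - exp (- (e * d)))"
    by (simp add: p_def q_def algebra_simps flip: exp_add)
  moreover have "1 - exp (- (e * d)) \<le> e * d" using exp_ge_add_one_self[of "- (e * d)"] by linarith
  ultimately have 1: "p - q \<le> p * (e * d)" using p by simp
  have 2: "0 \<le> p - q" using d e by (simp add: p_def q_def)
  have "p \<le> exp (- (2 * v))" using d e by (simp add: p_def v_def)
  hence "p / (1 - p) \<le> exp (- (2 * v)) / (1 - exp (- (2 * v)))"
    using p v by (intro frac_le) auto
  also have "\<dots> = 1 / (exp (2 * v) - 1)"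
    using v by (simp add: exp_minus field_simps)
  also have "\<dots> \<le> 1 / (v * exp v)"
  proof (intro divide_left_mono)
    have "exp (2 * v) - 1 = (exp v - 1) * (exp v + 1)"
      by (simp add: algebra_simps flip: exp_add)
    also have "\<dots> \<ge> v * exp v"
      using exp_ge_add_one_self[of v] v by (intro mult_mono) (simp_all add: algebra_simps)
    finally show "v * exp v \<le> exp (2 * v) - 1" .
  qed (use v in auto)
  finally have 3: "p / (1 - p) \<le> 1 / (v * exp v)" .
  \<comment> \<open>Half of the decay exp (- v) is spent on absorbing the factor v; what remains is
    exp (- d/8).\<close>
  have "v / 2 \<le> exp (v / 2)" using exp_ge_add_one_self[of "v/2"] by linarith
  hence "v * exp (- v) \<le> (2 * exp (v / 2)) * exp (- v)"
    by (intro mult_right_mono) auto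
  also have "\<dots> = 2 * exp (- (v / 2))" by (simp flip: exp_add)
  finally have 4: "v * exp (- v) \<le> 2 * exp (- (v / 2))" .
  have "q * (q / p) + (1 - q) * ((1 - q) / (1 - p)) = 1 + (p - q)^2 / (p * (1 - p))"
    using p by (simp add: field_simps power2_eq_square)
  also have "\<dots> \<le> 1 + (p * (e * d))^2 / (p * (1 - p))"
    using p 1 2 by (intro add_left_mono divide_right_mono power_mono) auto
  also have "\<dots> = 1 + (e * d)^2 * (p / (1 - p))"
    using p by (simp add: field_simps power2_eq_square)
  also have "\<dots> \<le> 1 + (e * d)^2 * (1 / (v * exp v))"
    using 3 by (intro add_left_mono mult_left_mono) auto
  also have "\<dots> = 1 + 16 * e^2 * (v * exp (- v))"
    using v by (simp add: exp_minus field_simps power2_eq_square v_def)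
  also have "\<dots> \<le> 1 + 16 * e^2 * (2 * exp (- (v / 2)))"
    using 4 by (intro add_left_mono mult_left_mono) auto
  also have "\<dots> = 1 + 32 * e^2 * exp (- (d / 8))" by (simp add: v_def)
  also have "\<dots> \<le> exp (32 * e^2 * exp (- (d / 8)))" by simp
  finally show ?thesis .
qed

text \<open>Groups the pairs by their larger endpoint, the order in which points are added in the
  martingale argument.\<close>

lemma sum_vertex_pairs:
  fixes f :: "nat \<Rightarrow> nat \<Rightarrow> real"
  shows "(\<Sum>(i, j)\<in>vertex_pairs m. f i j) = (\<Sum>j\<in>{1..m}. \<Sum>i\<in>{1..<j}. f i j)"
proof -
  have "(\<Sum>j\<in>{1..m}. \<Sum>i\<in>{1..<j}. f i j) = (\<Sum>(j, i)\<in>Sigma {1..m} (\<lambda>j. {1..<j}). f i j)"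
    by (simp add: sum.Sigma)
  also have "\<dots> = (\<Sum>(i, j)\<in>vertex_pairs m. f i j)"
    by (rule sum.reindex_bij_witness[of _ prod.swap prod.swap]) (auto simp: vertex_pairs_def)
  finally show ?thesis ..
qed

text \<open>Compression scales every distance by the same factor 1 - e, and the expectation of a
  product over independent coins is the product of the expectations, so
  \<open>chi_square_edge\<close> applies edge by edge.\<close>

lemma chi_square_compression:
  assumes e: "0 < e" "e \<le> 1/2"
    and Y: "\<And>i. i \<in> {1..m} \<Longrightarrow> Y i = (1 - e) * X i"
  shows "set_pmf (edge_coins m X) \<subseteq> set_pmf (edge_coins m Y)" (is ?dom)
    and "measure_pmf.expectation (edge_coins m X) (\<lambda>b. pmf (edge_coins m X) b / pmf (edge_coins m Y) b)
      \<le> exp (32 * e^2 * (\<Sum>j\<in>{1..m}. \<Sum>i\<in>{1..<j}. exp (- (\<bar>X i - X j\<bar> / 8))))" (is ?chi)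
proof -
  define c where "c = (\<lambda>(Z :: nat \<Rightarrow> real) (i, j). bernoulli_pmf (exp (- \<bar>Z i - Z j\<bar>)))"
  have coins: "edge_coins m Z = Pi_pmf (vertex_pairs m) False (c Z)" for Z
    by (simp add: edge_coins_def c_def)
  have dist: "\<bar>Y i - Y j\<bar> = (1 - e) * \<bar>X i - X j\<bar>" if "(i, j) \<in> vertex_pairs m" for i j
  proof -
    have "Y i - Y j = (1 - e) * (X i - X j)"
      using that Y by (auto simp: vertex_pairs_def algebra_simps)
    thus ?thesis using e by (simp add: abs_mult)
  qed
  \<comment> \<open>Edge probabilities are positive, so the inclusion could only fail where
    \<open>Y\<close> makes an edge certain. That means distance 0, and then \<open>X\<close> makes
    it certain too.\<close>
  have "set_pmf (c X z) \<subseteq> set_pmf (c Y z)" if z: "z \<in> vertex_pairs m" for z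
  proof (cases z)
    case (Pair i j)
    show ?thesis
    proof (cases "X i = X j")
      case True
      thus ?thesis using dist[of i j] z Pair by (simp add: c_def)
    next
      case False
      hence "\<bar>Y i - Y j\<bar> > 0" using dist[of i j] z Pair e by simp
      thus ?thesis using Pair by (simp add: c_def)
    qed
  qed
  thus ?dom by (simp add: coins set_Pi_pmf PiE_dflt_def) blast
  have "measure_pmf.expectation (edge_coins m X) (\<lambda>b. pmf (edge_coins m X) b / pmf (edge_coins m Y) b)
     = measure_pmf.expectation (edge_coins m X)
         (\<lambda>b. \<Prod>z\<in>vertex_pairs m. pmf (c X z) (b z) / pmf (c Y z) (b z))"
    \<comment> \<open>The product formula for the mass holds only for outcomes that are
      \<open>False\<close> off \<open>vertex_pairs m\<close>, hence the restriction to the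
      support.\<close>
    by (intro integral_cong_AE AE_pmfI)
       (auto simp: coins pmf_Pi prod_dividef dest!: subsetD[OF set_Pi_pmf_subset, rotated])
  also have "\<dots> = (\<Prod>z\<in>vertex_pairs m. measure_pmf.expectation (c X z)
         (\<lambda>v. pmf (c X z) v / pmf (c Y z) v))"
    unfolding coins
    by (subst expectation_prod_Pi_pmf) (auto intro: integrable_measure_pmf_finite)
  also have "\<dots> \<le> (\<Prod>z\<in>vertex_pairs m. exp (32 * e^2 * (case z of (i, j) \<Rightarrow> exp (- (\<bar>X i - X j\<bar> / 8)))))"
  proof (intro prod_mono conjI)
    fix z assume z: "z \<in> vertex_pairs m"
    obtain i j where ij: "z = (i, j)" by force
    show "measure_pmf.expectation (c X z) (\<lambda>v. pmf (c X z) v / pmf (c Y z) v)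
       \<le> exp (32 * e^2 * (case z of (i, j) \<Rightarrow> exp (- (\<bar>X i - X j\<bar> / 8))))"
      using chi_square_edge[OF e, of "\<bar>X i - X j\<bar>"] dist[of i j] z e
      by (simp add: c_def ij mult_ac)
    show "0 \<le> measure_pmf.expectation (c X z) (\<lambda>v. pmf (c X z) v / pmf (c Y z) v)"
      by (intro Bochner_Integration.integral_nonneg) auto
  qed
  also have "\<dots> = exp (32 * e^2 * (\<Sum>z\<in>vertex_pairs m. case z of (i, j) \<Rightarrow> exp (- (\<bar>X i - X j\<bar> / 8))))"
    by (simp add: exp_sum sum_distrib_left)
  finally show ?chi by (simp add: sum_vertex_pairs)
qed


section \<open>Sums of a kernel over pairs of independent points\<close>

locale pair_kernel = prob_space U for U :: "'a measure" +
  fixes g :: "'a \<Rightarrow> 'a \<Rightarrow> real" and \<kappa> :: real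
  assumes measurable_kernel: "(\<lambda>(x, t). g x t) \<in> borel_measurable (U \<Otimes>\<^sub>M U)"
    and kernel_nonneg: "0 \<le> g x t"
    and kernel_le_1: "g x t \<le> 1"
    and kernel_mean: "x \<in> space U \<Longrightarrow> (\<integral>t. g x t \<partial>U) \<le> \<kappa>"
begin

definition mean :: "'a \<Rightarrow> real" where
  "mean x = (\<integral>t. g x t \<partial>U)"

text \<open>For independent points with law \<open>U\<close>, the inner sum for \<open>j\<close> has
  mean zero given the points with index below \<open>j\<close>, so the inner sums are martingale
  differences.\<close>

definition fluctuation :: "nat \<Rightarrow> (nat \<Rightarrow> 'a) \<Rightarrow> real" where
  "fluctuation m X = (\<Sum>j\<in>{1..m}. \<Sum>i\<in>{1..<j}. g (X i) (X j) - mean (X i))"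

lemma measurable_kernel_right [measurable]: "x \<in> space U \<Longrightarrow> g x \<in> borel_measurable U"
  using measurable_Pair2[OF measurable_kernel] by simp

lemma integrable_kernel [simp]: "x \<in> space U \<Longrightarrow> integrable U (g x)"
  by (intro integrable_const_bound[of _ 1]) (auto simp: kernel_nonneg kernel_le_1)

lemma mean_nonneg: "0 \<le> mean x"
  unfolding mean_def using kernel_nonneg by (intro Bochner_Integration.integral_nonneg) auto

lemma mean_le_1: "mean x \<le> 1"
\<comment> \<open>The point \<open>x\<close> may lie outside \<open>space U\<close>; a section that
  is not integrable has integral 0 by convention.\<close>
proof (cases "integrable U (g x)")
  case True
  thus ?thesis unfolding mean_def by (intro integral_le_const) (auto simp: kernel_le_1)
qed (simp add: mean_def not_integrable_integral_eq)

lemma measurable_mean [measurable]: "mean \<in> borel_measurable U"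
  unfolding mean_def using measurable_kernel by measurable

lemma measurable_fluctuation:
  assumes "{1..m} \<subseteq> I"
  shows "fluctuation m \<in> borel_measurable (Pi\<^sub>M I (\<lambda>_. U))"
proof -
  have kernel: "(\<lambda>X. g (X i) (X j)) \<in> borel_measurable (Pi\<^sub>M I (\<lambda>_. U))" if "i \<in> I" "j \<in> I" for i j
    using measurable_compose[OF _ measurable_kernel, of "\<lambda>X. (X i, X j)" "Pi\<^sub>M I (\<lambda>_. U)"] that
    by simp
  have mean: "(\<lambda>X. mean (X i)) \<in> borel_measurable (Pi\<^sub>M I (\<lambda>_. U))" if "i \<in> I" for i
    using that by (intro measurable_compose[OF _ measurable_mean] measurable_component_singleton)
  show ?thesis
    unfolding fluctuation_def using assms
    by (intro borel_measurable_sum borel_measurable_diff kernel mean) auto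
qed

text \<open>A crude bound that makes the square integrable; the useful estimate is
  \<open>second_moment_fluctuation\<close>.\<close>

lemma abs_fluctuation_le: "\<bar>fluctuation m X\<bar> \<le> real m ^ 2"
proof -
  have "\<bar>g x t - mean x\<bar> \<le> 1" for x t
    using kernel_nonneg[of x t] kernel_le_1[of x t] mean_nonneg[of x] mean_le_1[of x] by linarith
  hence "\<bar>fluctuation m X\<bar> \<le> (\<Sum>j\<in>{1..m}. \<Sum>i\<in>{1..<j}. 1)"
    unfolding fluctuation_def by (intro order.trans[OF sum_abs] sum_mono order.trans[OF sum_abs]) auto
  also have "\<dots> \<le> (\<Sum>j\<in>{1..m}. real m)"
    by (intro sum_mono) auto
  finally show ?thesis by (simp add: power2_eq_square)
qed

lemma integrable_fluctuation_sq:
  "integrable (Pi\<^sub>M {1..m} (\<lambda>_. U)) (\<lambda>X. (fluctuation m X)\<^sup>2)"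
proof -
  interpret P: prob_space "Pi\<^sub>M {1..m} (\<lambda>_. U)" by (intro prob_space_PiM prob_space_axioms)
  have "(fluctuation m X)\<^sup>2 \<le> (real m ^ 2)\<^sup>2" for X
    using abs_fluctuation_le[of m X] by (intro power2_le_iff_abs_le[THEN iffD2]) auto
  thus ?thesis using measurable_fluctuation[of m "{1..m}"]
    by (intro P.integrable_const_bound[of _ "(real m ^ 2)\<^sup>2"]) auto
qed

text \<open>The new point t adds T(t) - E T, where T(t) is its total kernel value against the old
  points. The cross term has mean zero, so the second moment grows by Var T <= E T^2 <= m E T,
  because 0 <= T <= m. Finally E T <= m \<kappa>.\<close>

lemma second_moment_step:
  assumes X: "\<And>i. i \<in> {1..m} \<Longrightarrow> X i \<in> space U"
  shows "(\<integral>t. (fluctuation (Suc m) (X(Suc m := t)))\<^sup>2 \<partial>U) \<le> (fluctuation m X)\<^sup>2 + real m ^ 2 * \<kappa>"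
proof -
  define T where "T = (\<lambda>t. \<Sum>i\<in>{1..m}. g (X i) t)"
  have T_meas [measurable]: "T \<in> borel_measurable U"
    unfolding T_def using X by (intro borel_measurable_sum measurable_kernel_right)
  have T0: "0 \<le> T t" for t using kernel_nonneg by (auto simp: T_def intro: sum_nonneg)
  have Tm: "T t \<le> real m" for t
    using sum_bounded_above[of "{1..m}" "\<lambda>i. g (X i) t" 1] kernel_le_1 by (auto simp: T_def)
  have T_int: "integrable U T" unfolding T_def using X by (intro Bochner_Integration.integrable_sum integrable_kernel)
  have T2_int: "integrable U (\<lambda>t. (T t)\<^sup>2)"
    by (intro integrable_const_bound[of _ "(real m)\<^sup>2"]) (auto intro!: power_mono T0 Tm)
  have ET: "(\<integral>t. T t \<partial>U) = (\<Sum>i\<in>{1..m}. mean (X i))"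
    unfolding T_def mean_def using X by (intro Bochner_Integration.integral_sum integrable_kernel)
  also have "\<dots> \<le> real m * \<kappa>"
    using sum_bounded_above[of "{1..m}" "\<lambda>i. mean (X i)" \<kappa>] X kernel_mean by (auto simp: mean_def)
  finally have ET_le: "(\<integral>t. T t \<partial>U) \<le> real m * \<kappa>" .
  have "(\<integral>t. (T t)\<^sup>2 \<partial>U) \<le> (\<integral>t. real m * T t \<partial>U)"
    using T2_int T_int T0 Tm by (intro integral_mono) (auto simp: power2_eq_square intro: mult_right_mono)
  also have "\<dots> \<le> real m * (real m * \<kappa>)"
    using ET_le by (simp add: mult_left_mono)
  finally have T2_le: "(\<integral>t. (T t)\<^sup>2 \<partial>U) \<le> real m ^ 2 * \<kappa>" by (simp add: power2_eq_square)
  have eq: "fluctuation (Suc m) (X(Suc m := t)) = fluctuation m X + (T t - (\<integral>t. T t \<partial>U))" for t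
  proof -
    have "{1..Suc m} = insert (Suc m) {1..m}" by auto
    moreover have "fluctuation m (X(Suc m := t)) = fluctuation m X"
      unfolding fluctuation_def by (intro sum.cong refl) auto
    moreover have "(\<Sum>i\<in>{1..<Suc m}. g ((X(Suc m := t)) i) t - mean ((X(Suc m := t)) i))
        = (\<Sum>i\<in>{1..m}. g (X i) t - mean (X i))"
      by (intro sum.cong) auto
    ultimately show ?thesis
      unfolding ET by (simp add: fluctuation_def T_def sum_subtractf)
  qed
  define a where "a = fluctuation m X - (\<integral>t. T t \<partial>U)"
  have "(\<integral>t. (fluctuation (Suc m) (X(Suc m := t)))\<^sup>2 \<partial>U) = (\<integral>t. a\<^sup>2 + 2 * a * T t + (T t)\<^sup>2 \<partial>U)"
    by (intro Bochner_Integration.integral_cong) (simp_all add: eq a_def power2_eq_square algebra_simps)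
  also have "\<dots> = a\<^sup>2 + 2 * a * (\<integral>t. T t \<partial>U) + (\<integral>t. (T t)\<^sup>2 \<partial>U)"
    using T_int T2_int by (simp add: prob_space)
  also have "\<dots> = (fluctuation m X)\<^sup>2 - (\<integral>t. T t \<partial>U)\<^sup>2 + (\<integral>t. (T t)\<^sup>2 \<partial>U)"
    by (simp add: a_def power2_eq_square algebra_simps)
  finally show ?thesis using T2_le zero_le_power2[of "\<integral>t. T t \<partial>U"] by linarith
qed

text \<open>Fubini integrates out the last point first, and the growth m^2 \<kappa> per step sums to
  at most m^3 \<kappa>.\<close>

lemma second_moment_fluctuation:
  "(\<integral>X. (fluctuation m X)\<^sup>2 \<partial>Pi\<^sub>M {1..m} (\<lambda>_. U)) \<le> real m ^ 3 * \<kappa>"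
proof (induction m)
  case 0
  show ?case by (simp add: fluctuation_def)
next
  case (Suc m)
  interpret P: prob_space "Pi\<^sub>M {1..m} (\<lambda>_. U)" by (intro prob_space_PiM prob_space_axioms)
  interpret S: product_sigma_finite "\<lambda>_::nat. U" ..
  obtain x where "x \<in> space U" using not_empty by auto
  hence "0 \<le> \<kappa>" using kernel_mean[of x] mean_nonneg[of x] by (simp add: mean_def)
  have ins: "{1..Suc m} = insert (Suc m) {1..m}" by auto
  have "(\<integral>X. (fluctuation (Suc m) X)\<^sup>2 \<partial>Pi\<^sub>M {1..Suc m} (\<lambda>_. U))
     = (\<integral>X. (\<integral>t. (fluctuation (Suc m) (X(Suc m := t)))\<^sup>2 \<partial>U) \<partial>Pi\<^sub>M {1..m} (\<lambda>_. U))"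
    unfolding ins by (intro S.product_integral_insert integrable_fluctuation_sq[of "Suc m", unfolded ins]) auto
  also have "\<dots> \<le> (\<integral>X. (fluctuation m X)\<^sup>2 + real m ^ 2 * \<kappa> \<partial>Pi\<^sub>M {1..m} (\<lambda>_. U))"
    using \<open>0 \<le> \<kappa>\<close>
    by (intro integral_mono_AE' AE_I2 second_moment_step Bochner_Integration.integrable_add
          integrable_fluctuation_sq Bochner_Integration.integral_nonneg P.integrable_const add_nonneg_nonneg)
       (auto simp: space_PiM)
  also have "\<dots> = (\<integral>X. (fluctuation m X)\<^sup>2 \<partial>Pi\<^sub>M {1..m} (\<lambda>_. U)) + real m ^ 2 * \<kappa>"
    using integrable_fluctuation_sq[of m] by (simp add: P.prob_space del: One_nat_def)
  also have "\<dots> \<le> (real m ^ 3 + real m ^ 2) * \<kappa>"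
    using Suc.IH by (simp add: algebra_simps)
  also have "\<dots> \<le> real (Suc m) ^ 3 * \<kappa>"
    using \<open>0 \<le> \<kappa>\<close> by (intro mult_right_mono) (auto simp: power2_eq_square power3_eq_cube algebra_simps)
  finally show ?case .
qed

lemma fluctuation_tail:
  assumes "a > 0"
  shows "measure (Pi\<^sub>M {1..m} (\<lambda>_. U)) {X \<in> space (Pi\<^sub>M {1..m} (\<lambda>_. U)). \<bar>fluctuation m X\<bar> \<ge> a}
    \<le> real m ^ 3 * \<kappa> / a\<^sup>2"
proof -
  interpret P: prob_space "Pi\<^sub>M {1..m} (\<lambda>_. U)" by (intro prob_space_PiM prob_space_axioms)
  have "measure (Pi\<^sub>M {1..m} (\<lambda>_. U)) {X \<in> space (Pi\<^sub>M {1..m} (\<lambda>_. U)). \<bar>fluctuation m X\<bar> \<ge> a}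
    \<le> (\<integral>X. (fluctuation m X)\<^sup>2 \<partial>Pi\<^sub>M {1..m} (\<lambda>_. U)) / a\<^sup>2"
    using assms by (intro P.second_moment_method measurable_fluctuation integrable_fluctuation_sq) auto
  also have "\<dots> \<le> real m ^ 3 * \<kappa> / a\<^sup>2"
    by (intro divide_right_mono second_moment_fluctuation) auto
  finally show ?thesis .
qed

text \<open>Puts the subtracted conditional means back: at most m^2 of them, each at most
  \<kappa>.\<close>

lemma pair_sum_le:
  assumes X: "\<And>i. i \<in> {1..m} \<Longrightarrow> X i \<in> space U"
  shows "(\<Sum>j\<in>{1..m}. \<Sum>i\<in>{1..<j}. g (X i) (X j)) \<le> fluctuation m X + real m ^ 2 * \<kappa>"
proof -
  obtain x where "x \<in> space U" using not_empty by auto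
  hence "0 \<le> \<kappa>" using kernel_mean[of x] mean_nonneg[of x] by (simp add: mean_def)
  have "(\<Sum>j\<in>{1..m}. \<Sum>i\<in>{1..<j}. mean (X i)) \<le> (\<Sum>j\<in>{1..m}. \<Sum>i\<in>{1..<j}. \<kappa>)"
    using X kernel_mean by (intro sum_mono) (auto simp: mean_def)
  also have "\<dots> \<le> (\<Sum>j\<in>{1..m}. real m * \<kappa>)"
    using \<open>0 \<le> \<kappa>\<close> by (intro sum_mono) (auto intro!: mult_right_mono)
  finally show ?thesis
    by (simp add: fluctuation_def sum_subtractf power2_eq_square)
qed

end

section \<open>The exponential kernel under the uniform law on an interval\<close>

lemma nn_integral_exp_decay:
  "(\<integral>\<^sup>+t. ennreal (exp (- (\<bar>x - t\<bar> / 8))) \<partial>lborel) \<le> 16"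
proof -
  define h :: "real \<Rightarrow> ennreal" where "h = (\<lambda>t. ennreal (exp (- (t / 8))) * indicator {0..} t)"
  have [measurable]: "h \<in> borel_measurable borel" by (simp add: h_def)
  have "(\<integral>\<^sup>+t. h t \<partial>lborel) = ennreal (0 - (- 8 * exp (- (0 / 8))))"
    unfolding h_def
  proof (rule nn_integral_FTC_atLeast)
    show "((\<lambda>t. - 8 * exp (- (t / 8))) has_real_derivative exp (- (t / 8))) (at t)" for t :: real
      by (auto intro!: derivative_eq_intros)
    show "((\<lambda>t::real. - 8 * exp (- (t / 8))) \<longlongrightarrow> 0) at_top" by real_asymp
  qed auto
  hence h: "(\<integral>\<^sup>+t. h t \<partial>lborel) = 8" by simp
  have "(\<integral>\<^sup>+t. ennreal (exp (- (\<bar>x - t\<bar> / 8))) \<partial>lborel) = (\<integral>\<^sup>+t. ennreal (exp (- (\<bar>t\<bar> / 8))) \<partial>lborel)"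
    using nn_integral_real_affine[of "\<lambda>t. ennreal (exp (- (\<bar>t\<bar> / 8)))" "-1" x] by simp
  \<comment> \<open>Two reflected one-sided exponentials, each of mass 8. They overlap at 0, hence
    only an inequality.\<close>
  also have "\<dots> \<le> (\<integral>\<^sup>+t. h t + h (- t) \<partial>lborel)"
    by (intro nn_integral_mono) (auto simp: h_def indicator_def)
  also have "\<dots> = (\<integral>\<^sup>+t. h t \<partial>lborel) + (\<integral>\<^sup>+t. h (- t) \<partial>lborel)"
    by (intro nn_integral_add) auto
  also have "(\<integral>\<^sup>+t. h (- t) \<partial>lborel) = (\<integral>\<^sup>+t. h t \<partial>lborel)"
    using nn_integral_real_affine[of h "-1" 0] by simp
  finally show ?thesis using h by simp
qed

text \<open>Enlarging the domain of integration from the interval to the whole line removes the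
  dependence on x; the density contributes the factor 1/n.\<close>

lemma pair_kernel_exp:
  assumes n: "n > 0"
  shows "pair_kernel (uniform_measure lborel {0..n}) (\<lambda>x t. exp (- (\<bar>x - t\<bar> / 8))) (16 / n)"
proof -
  let ?U = "uniform_measure lborel {0..n}"
  interpret prob_space ?U using n by (intro prob_space_uniform_measure) auto
  show ?thesis
  proof
    fix x :: real
    let ?g = "\<lambda>t. exp (- (\<bar>x - t\<bar> / 8)) :: real"
    have "ennreal (\<integral>t. ?g t \<partial>?U) = (\<integral>\<^sup>+t. ennreal (?g t) \<partial>?U)"
      by (intro nn_integral_eq_integral[symmetric] integrable_const_bound[of _ 1]) auto
    also have "\<dots> = (\<integral>\<^sup>+t. ennreal (?g t) * indicator {0..n} t \<partial>lborel) / ennreal n"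
      using n by (subst nn_integral_uniform_measure) auto
    also have "\<dots> \<le> (\<integral>\<^sup>+t. ennreal (?g t) \<partial>lborel) / ennreal n"
      by (intro divide_right_mono_ennreal nn_integral_mono) (auto simp: indicator_def)
    also have "\<dots> \<le> 16 / ennreal n"
      by (intro divide_right_mono_ennreal nn_integral_exp_decay)
    also have "\<dots> = ennreal (16 / n)"
      using n by (simp flip: divide_ennreal)
    finally show "(\<integral>t. ?g t \<partial>?U) \<le> 16 / n"
      using n by (simp add: ennreal_le_iff)
  qed auto
qed


section \<open>Indistinguishable position vectors\<close>

text \<open>The constant is half of 3/(4 C) with C = exp 576, the half coming from the uniform
  choice between \<open>X\<close> and \<open>Y\<close>.\<close>

lemma indistinguishable_far_vector:
  fixes X :: "nat \<Rightarrow> real" and n \<delta> :: real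
  assumes X: "X \<in> position_vectors n m"
    and m: "1 \<le> m" and \<delta>: "0 < \<delta>" "6 * \<delta> \<le> n"
    and S: "(\<Sum>j\<in>{1..m}. \<Sum>i\<in>{1..<j}. exp (- (\<bar>X i - X j\<bar> / 8))) \<le> 2 * n\<^sup>2 / \<delta>\<^sup>2"
  shows "\<exists>Y\<in>position_vectors n m. same_vertex_order m X Y \<and> far m \<delta> X Y \<and>
    (\<forall>\<Psi> \<in> graphs m \<rightarrow> {X, Y}.
       3/8 * exp (- 576) \<le> measure_pmf.prob (testing_experiment m X Y) {(Z, G). \<Psi> G \<noteq> Z})"
proof -
  have X0n: "0 \<le> X i" "X i \<le> n" if "i \<in> {1..m}" for i
    using X that by (auto simp: position_vectors_def)
  show ?thesis
  proof (cases "\<exists>k\<in>{1..m}. n / 2 < X k")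
    case False
    \<comment> \<open>All points are at most n/2 and 6 \<delta> <= n, so the shifted points stay in
      the interval.\<close>
    define Y where "Y = (\<lambda>i\<in>{1..m}. X i + 2 * \<delta>)"
    have far: "far m \<delta> X Y"
      using m \<delta> by (auto simp: far_def Y_def intro!: bexI[of _ 1])
    have Y: "Y \<in> position_vectors n m"
      using False X0n \<delta> by (auto simp: position_vectors_def Y_def not_less)
    have order: "same_vertex_order m X Y" by (simp add: same_vertex_order_def Y_def)
    have same_law: "edge_coins m Y = edge_coins m X"
      unfolding edge_coins_def by (intro Pi_pmf_cong) (auto simp: vertex_pairs_def Y_def)
    have "2 * (3/8 * exp (- 576)) \<le> measure_pmf.prob (edge_coins m X) B
        + measure_pmf.prob (edge_coins m Y) (- B)" for B
    proof -
      have "exp (- 576) \<le> (1 :: real)" by simp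
      thus ?thesis
        using measure_pmf.prob_compl[of B "edge_coins m X"] same_law
        by (simp add: Compl_eq_Diff_UNIV del: exp_le_one_iff)
    qed
    moreover have "X \<noteq> Y" using far \<delta> by (auto simp: far_def)
    ultimately show ?thesis using Y order far testing_error_ge by blast
  next
    case True
    then obtain k where k: "k \<in> {1..m}" "n / 2 < X k" by blast
    \<comment> \<open>A point beyond n/2 moves by more than e n/2 = 1.5 \<delta>, and 6 \<delta> <=
      n gives e <= 1/2.\<close>
    define e where "e = 3 * \<delta> / n"
    have e: "0 < e" "e \<le> 1/2" using \<delta> by (auto simp: e_def field_simps)
    define Y where "Y = (\<lambda>i\<in>{1..m}. (1 - e) * X i)"
    have "\<delta> < e * X k"
    proof -
      have "\<delta> < e * (n / 2)" using \<delta> by (simp add: e_def)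
      also have "\<dots> < e * X k" using k e by simp
      finally show ?thesis .
    qed
    hence far: "far m \<delta> X Y"
      using k by (auto simp: far_def Y_def algebra_simps intro!: bexI[of _ k])
    have "(1 - e) * X i \<le> n" if "i \<in> {1..m}" for i
      using X0n[OF that] e mult_right_mono[of "1 - e" 1 "X i"] by linarith
    hence Y: "Y \<in> position_vectors n m"
      using X0n e by (auto simp: position_vectors_def Y_def)
    have order: "same_vertex_order m X Y" using e by (simp add: same_vertex_order_def Y_def)
    have YX: "Y i = (1 - e) * X i" if "i \<in> {1..m}" for i using that by (simp add: Y_def)
    note chi_square_compression(2)[OF e YX]
    also have "32 * e\<^sup>2 * (\<Sum>j\<in>{1..m}. \<Sum>i\<in>{1..<j}. exp (- (\<bar>X i - X j\<bar> / 8))) \<le> 32 * e\<^sup>2 * (2 * n\<^sup>2 / \<delta>\<^sup>2)"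
      using S by (intro mult_left_mono) auto
    also have "\<dots> = 576" using \<delta> by (simp add: e_def field_simps power2_eq_square)
    finally have chi: "measure_pmf.expectation (edge_coins m X)
        (\<lambda>b. pmf (edge_coins m X) b / pmf (edge_coins m Y) b) \<le> exp 576"
      by simp
    have "finite (set_pmf (edge_coins m X))"
      by (auto simp: edge_coins_def set_Pi_pmf intro!: finite_PiE_dflt)
    hence "2 * (3/8 * exp (- 576)) \<le> measure_pmf.prob (edge_coins m X) B
        + measure_pmf.prob (edge_coins m Y) (- B)" for B
      using two_point_error_ge[OF _ chi_square_compression(1)[OF e YX] chi, of B]
      by (simp add: exp_minus field_simps)
    moreover have "X \<noteq> Y" using far \<delta> by (auto simp: far_def)
    ultimately show ?thesis using Y order far testing_error_ge by blast
  qed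
qed

text \<open>The first bound controls the conditional means in the pair sum, the second the Chebyshev
  tail. In terms of s = n^(1/4) all powers become integral, and the range of m reads m \<delta> <
  s^6/20.\<close>

lemma sample_size_bounds:
  fixes n \<delta> :: real
  assumes n: "0 < n" and \<delta>: "0 < \<delta>" "\<delta> \<le> n powr (1/4)"
    and m: "real m < 0.05 * n powr 1.5 / \<delta>"
  shows "real m ^ 2 * (16 / n) \<le> n\<^sup>2 / \<delta>\<^sup>2"
    and "real m ^ 3 * (16 / n) / (n\<^sup>2 / \<delta>\<^sup>2)\<^sup>2 \<le> 1 / n powr (1/4)"
proof -
  define s where "s = n powr (1/4)"
  have s: "s > 0" using n by (simp add: s_def)
  have n_eq: "n = s ^ 4"
    using n powr_realpow[OF s, of 4] by (simp add: s_def powr_powr)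
  have n15: "n powr 1.5 = s ^ 6"
    using n powr_realpow[OF s, of 6] by (simp add: s_def powr_powr)
  have m\<delta>: "real m * \<delta> \<le> s ^ 6 / 20" using m[unfolded n15] \<delta> by (simp add: field_simps)
  have "(real m * \<delta>) ^ 2 \<le> (s ^ 6 / 20) ^ 2" using m\<delta> \<delta> by (intro power_mono) auto
  moreover have "(s ^ 6 / 20) ^ 2 = s ^ 12 / 400" by (simp add: power_divide flip: power_mult)
  ultimately have "16 * (real m * \<delta>) ^ 2 \<le> s ^ 12"
    using zero_le_power2[of "real m * \<delta>"] by linarith
  hence "16 * (real m * \<delta>) ^ 2 / (s ^ 4 * \<delta>\<^sup>2) \<le> s ^ 12 / (s ^ 4 * \<delta>\<^sup>2)"
    using s \<delta> by (intro divide_right_mono) auto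
  thus "real m ^ 2 * (16 / n) \<le> n\<^sup>2 / \<delta>\<^sup>2"
    using s \<delta> by (simp add: n_eq power_mult_distrib field_simps flip: power_mult power_add)
  have "(real m * \<delta>) ^ 3 \<le> (s ^ 6 / 20) ^ 3" using m\<delta> \<delta> by (intro power_mono) auto
  moreover have "(s ^ 6 / 20) ^ 3 = s ^ 18 / 8000" by (simp add: power_divide flip: power_mult)
  moreover have "0 \<le> (real m * \<delta>) ^ 3" using \<delta> by simp
  ultimately have "16 * (real m * \<delta>) ^ 3 \<le> s ^ 18" by linarith
  \<comment> \<open>The tail is at most \<delta>/s^2; bounding the spare \<delta> by s leaves the
    rate 1/s, which no longer depends on \<delta>.\<close>
  hence "16 * (real m * \<delta>) ^ 3 * \<delta> \<le> s ^ 18 * s"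
    using \<delta> s by (intro mult_mono) (auto simp: s_def)
  hence "16 * (real m * \<delta>) ^ 3 * \<delta> / s ^ 20 \<le> s ^ 18 * s / s ^ 20"
    using s by (intro divide_right_mono) auto
  also have "\<dots> = 1 / s" using s by (simp add: field_simps flip: power_Suc power_Suc2)
  also have "16 * (real m * \<delta>) ^ 3 * \<delta> / s ^ 20 = real m ^ 3 * (16 / n) / (n\<^sup>2 / \<delta>\<^sup>2)\<^sup>2"
  proof -
    have "(n\<^sup>2)\<^sup>2 * n = s ^ 20" by (simp add: n_eq flip: power_mult power_add)
    thus ?thesis using s \<delta> n by (simp add: field_simps power2_eq_square power3_eq_cube)
  qed
  finally show "real m ^ 3 * (16 / n) / (n\<^sup>2 / \<delta>\<^sup>2)\<^sup>2 \<le> 1 / n powr (1/4)" by (simp add: s_def)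
qed

section \<open>The event of good position vectors and its probability\<close>

theorem theorem4p2:
  "\<exists>p::real. p > 0 \<and>
     (\<forall>\<delta>::real. \<delta> > 0 \<longrightarrow>
       (\<exists>a::real. a > 0 \<and>
         (\<forall>\<^sub>F n::real in at_top. \<forall>m::nat.
            1 \<le> m \<and> real m < 0.05 * n powr 1.5 / \<delta> \<longrightarrow>
            (\<exists>A \<in> sets (uniform_positions n m).
               measure (uniform_positions n m) A \<ge> 1 - 1 / n powr a \<and>
               (\<forall>X\<in>A. \<exists>Y\<in>position_vectors n m.
                  same_vertex_order m X Y \<and> far m \<delta> X Y \<and>
                  (\<forall>\<Psi> \<in> graphs m \<rightarrow> {X, Y}.
                     measure_pmf.prob (testing_experiment m X Y) {(Z, G). \<Psi> G \<noteq> Z} \<ge> p))))))"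
proof (rule exI[of _ "3/8 * exp (- 576)"], intro conjI allI impI)
  show "0 < 3/8 * exp (- 576 :: real)" by simp
  fix \<delta> :: real assume \<delta>: "\<delta> > 0"
  have large: "\<forall>\<^sub>F n::real in at_top. 6 * \<delta> \<le> n" "\<forall>\<^sub>F n::real in at_top. \<delta> \<le> n powr (1/4)"
    by real_asymp+
  show "\<exists>a::real. a > 0 \<and>
         (\<forall>\<^sub>F n::real in at_top. \<forall>m::nat.
            1 \<le> m \<and> real m < 0.05 * n powr 1.5 / \<delta> \<longrightarrow>
            (\<exists>A \<in> sets (uniform_positions n m).
               measure (uniform_positions n m) A \<ge> 1 - 1 / n powr a \<and>
               (\<forall>X\<in>A. \<exists>Y\<in>position_vectors n m.
                  same_vertex_order m X Y \<and> far m \<delta> X Y \<and>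
                  (\<forall>\<Psi> \<in> graphs m \<rightarrow> {X, Y}.
                     measure_pmf.prob (testing_experiment m X Y) {(Z, G). \<Psi> G \<noteq> Z}
                       \<ge> 3/8 * exp (- 576)))))"
  \<comment> \<open>Half of the exponent in \<delta>/sqrt n is given up to absorb \<delta>, which
    leaves 1/4.\<close>
  proof (rule exI[of _ "1/4"], intro conjI)
    show "\<forall>\<^sub>F n::real in at_top. \<forall>m::nat.
            1 \<le> m \<and> real m < 0.05 * n powr 1.5 / \<delta> \<longrightarrow>
            (\<exists>A \<in> sets (uniform_positions n m).
               measure (uniform_positions n m) A \<ge> 1 - 1 / n powr (1/4) \<and>
               (\<forall>X\<in>A. \<exists>Y\<in>position_vectors n m.
                  same_vertex_order m X Y \<and> far m \<delta> X Y \<and>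
                  (\<forall>\<Psi> \<in> graphs m \<rightarrow> {X, Y}.
                     measure_pmf.prob (testing_experiment m X Y) {(Z, G). \<Psi> G \<noteq> Z}
                       \<ge> 3/8 * exp (- 576))))"
      using large
    proof (eventually_elim, intro allI impI, elim conjE)
      fix n :: real and m :: nat
      assume n6: "6 * \<delta> \<le> n" and n4: "\<delta> \<le> n powr (1/4)"
        and m1: "1 \<le> m" and m: "real m < 0.05 * n powr 1.5 / \<delta>"
      have n: "n > 0" using n6 \<delta> by linarith
      let ?U = "uniform_measure lborel {0..n}" and ?P = "uniform_positions n m"
      interpret K: pair_kernel ?U "\<lambda>x t. exp (- (\<bar>x - t\<bar> / 8))" "16 / n"
        using n by (rule pair_kernel_exp)
      interpret S: product_sigma_finite "\<lambda>_::nat. ?U" ..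
      interpret P: prob_space ?P
        unfolding uniform_positions_def by (intro prob_space_PiM K.prob_space_axioms)
      \<comment> \<open>Half of the admissible pair sum: the fluctuation and the conditional means
        get \<open>c\<close> each.\<close>
      define c where "c = n\<^sup>2 / \<delta>\<^sup>2"
      have c: "c > 0" using n \<delta> by (simp add: c_def)
      define bad where "bad = {X \<in> space ?P. \<bar>K.fluctuation m X\<bar> \<ge> c}"
      have [measurable]: "K.fluctuation m \<in> borel_measurable ?P"
        unfolding uniform_positions_def by (rule K.measurable_fluctuation) simp
      have bad [measurable]: "bad \<in> sets ?P" unfolding bad_def by measurable
      have box [measurable]: "position_vectors n m \<in> sets ?P"
        unfolding position_vectors_def uniform_positions_def by (intro sets_PiM_I_finite) auto
      \<comment> \<open>The underlying space of \<open>?P\<close> contains vectors outside the box.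
        The box has full mass, so the good event can be taken inside it at no cost in
        probability.\<close>
      have "emeasure ?P (position_vectors n m) = (\<Prod>i\<in>{1..m}. emeasure ?U {0..n})"
        unfolding position_vectors_def uniform_positions_def by (intro S.emeasure_PiM) auto
      also have "\<dots> = 1" using n by (simp add: divide_ennreal)
      finally have box1: "P.prob (position_vectors n m) = 1" by (simp add: measure_def)
      have "P.prob bad \<le> real m ^ 3 * (16 / n) / c\<^sup>2"
        using K.fluctuation_tail[OF c, of m] by (simp add: bad_def uniform_positions_def)
      also have "\<dots> \<le> 1 / n powr (1/4)"
        unfolding c_def by (rule sample_size_bounds(2)[OF n \<delta> n4 m])
      finally have "P.prob bad \<le> 1 / n powr (1/4)" .
      moreover have "P.prob (position_vectors n m \<inter> bad) \<le> P.prob bad"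
        by (intro P.finite_measure_mono) auto
      ultimately have "1 - 1 / n powr (1/4) \<le> P.prob (position_vectors n m - bad)"
        using P.finite_measure_Diff'[OF box bad] box1 by linarith
      moreover have "\<exists>Y\<in>position_vectors n m. same_vertex_order m X Y \<and> far m \<delta> X Y \<and>
          (\<forall>\<Psi> \<in> graphs m \<rightarrow> {X, Y}.
             3/8 * exp (- 576) \<le> measure_pmf.prob (testing_experiment m X Y) {(Z, G). \<Psi> G \<noteq> Z})"
        if X: "X \<in> position_vectors n m - bad" for X
      proof (rule indistinguishable_far_vector)
        have "X \<in> space ?P" using X sets.sets_into_space[OF box] by auto
        hence "K.fluctuation m X \<le> c" using X by (auto simp: bad_def)
        moreover have "real m ^ 2 * (16 / n) \<le> c"
          unfolding c_def by (rule sample_size_bounds(1)[OF n \<delta> n4 m])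
        ultimately show "(\<Sum>j\<in>{1..m}. \<Sum>i\<in>{1..<j}. exp (- (\<bar>X i - X j\<bar> / 8))) \<le> 2 * n\<^sup>2 / \<delta>\<^sup>2"
          using K.pair_sum_le[of m X] by (simp add: c_def)
      qed (use X \<delta> n6 m1 in auto)
      ultimately show "\<exists>A \<in> sets ?P.
               measure ?P A \<ge> 1 - 1 / n powr (1/4) \<and>
               (\<forall>X\<in>A. \<exists>Y\<in>position_vectors n m.
                  same_vertex_order m X Y \<and> far m \<delta> X Y \<and>
                  (\<forall>\<Psi> \<in> graphs m \<rightarrow> {X, Y}.
                     measure_pmf.prob (testing_experiment m X Y) {(Z, G). \<Psi> G \<noteq> Z}
                       \<ge> 3/8 * exp (- 576)))"
        by (intro bexI[of _ "position_vectors n m - bad"]) auto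
    qed
  qed simp
qed

end
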